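(* Let $(\mathcal G,\rho,\omega)$ be a symplectic Lie--Rinehart--Jacobi algebra over $A$, and let $(\widehat{\mathcal G}_\omega,\widehat\rho)$, $\pi$, $\eta$ be its extension by $\omega$, the projection and the canonical $1$-form. For every $x\in\mathcal G$ and $f\in A$, $$\mathcal L^{\widehat\rho}_{x+fe}\,\eta=\pi^*\bigl(d_\rho f-i_x\omega\bigr).$$
   Context: $K$ is a commutative field of characteristic zero and $A$ a commutative unital $K$-algebra; $L_a$ is multiplication by $a$. $\mathrm{Diff}^1_K(A)$ is the set of $K$-linear $D:A\to A$ with $[[D,L_a],L_b]=0$ for all $a,b\in A$. A Lie--Rinehart--Jacobi (LRJ) algebra over $A$ is an $A$-module $\mathcal G$ with a $K$-Lie algebra structure and an $A$-linear map (anchor) $\rho:\mathcal G\to\mathrm{Diff}^1_K(A)$ which is a Lie algebra morphism and satisfies $[x,ay]=a[x,y]+(\rho(x)(a)-a\rho(x)(1_A))y$. $C^p_\rho(\mathcal G,A)=\mathrm{Alt}^p_A(\mathcal G,A)$ is the module of alternating $A$-multilinear maps $\mathcal G^p\to A$, with differential $(d_\rho\beta)(x_0,\dots,x_p)=\sum_i(-1)^i\rho(x_i)\beta(x_0,\dots,\widehat{x_i},\dots,x_p)+\sum_{i<j}(-1)^{i+j}\beta([x_i,x_j],x_0,\dots,\widehat{x_i},\dots,\widehat{x_j},\dots,x_p)$; in particular $(d_\rho a)(x)=\rho(x)(a)$. $i_x$ is the interior product and $\mathcal L^\rho_x=i_xd_\rho+d_\rho i_x$. The same notation is used for any LRJ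 algebra. A symplectic form on $(\mathcal G,\rho)$ is $\omega\in C^2_\rho(\mathcal G,A)$ with $d_\rho\omega=0$ and $\omega^\flat:\mathcal G\to\mathcal G^*=\mathrm{Hom}_A(\mathcal G,A)$, $x\mapsto i_x\omega$, an isomorphism of $A$-modules; $(\mathcal G,\rho,\omega)$ is then a symplectic LRJ algebra. The extension: $\widehat{\mathcal G}_\omega=\mathcal G\oplus Ae$ with $e$ generating a free summand of rank one, with bracket $[x+fe,y+ge]_\omega=[x,y]+(\rho(x)(g)-\rho(y)(f)+\omega(x,y))e$, anchor $\widehat\rho(x+fe)=\rho(x)$, projection $\pi(x+fe)=x$ and canonical form $\eta(x+fe)=f$ ($x,y\in\mathcal G$, $f,g\in A$). $(\widehat{\mathcal G}_\omega,\widehat\rho)$ is an LRJ algebra. For $\beta\in C^p_\rho(\mathcal G,A)$, $(\pi^*\beta)(u_1,\dots,u_p)=\beta(\pi(u_1),\dots,\pi(u_p))$. *)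

theory Defs
  imports Complex_Main "HOL-Library.Product_Plus"
begin

section \<open>First-order differential operators\<close>

locale comm_algebra = vector_space scaleK
  for scaleK :: "'k::field_char_0 \<Rightarrow> 'a::comm_ring_1 \<Rightarrow> 'a" +
  assumes scaleK_mult_left: "scaleK k (a * b) = scaleK k a * b"

definition commutator :: "('a \<Rightarrow> 'a) \<Rightarrow> ('a \<Rightarrow> 'a) \<Rightarrow> 'a \<Rightarrow> 'a::ab_group_add"
  where "commutator D E = (\<lambda>c. D (E c) - E (D c))"

definition Diff1 :: "('k::field_char_0 \<Rightarrow> 'a::comm_ring_1 \<Rightarrow> 'a) \<Rightarrow> ('a \<Rightarrow> 'a) set"
  where "Diff1 scaleK = {D. Vector_Spaces.linear scaleK scaleK D \<and>
    (\<forall>a b. commutator (commutator D ((*) a)) ((*) b) = (\<lambda>_. 0))}"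


section \<open>Lie--Rinehart--Jacobi algebras\<close>

text \<open>The \<open>K\<close>-vector space structure underlying an \<open>A\<close>-module.\<close>

definition restrict_scalars ::
    "('k \<Rightarrow> 'a \<Rightarrow> 'a) \<Rightarrow> ('a::comm_ring_1 \<Rightarrow> 'g \<Rightarrow> 'g) \<Rightarrow> 'k \<Rightarrow> 'g \<Rightarrow> 'g"
  where "restrict_scalars scaleK scale k x = scale (scaleK k 1) x"

locale lie_algebra = vector_space scaleK
  for scaleK :: "'k::field \<Rightarrow> 'g::ab_group_add \<Rightarrow> 'g" +
  fixes bracket :: "'g \<Rightarrow> 'g \<Rightarrow> 'g"
  assumes linear_bracket_left: "Vector_Spaces.linear scaleK scaleK (\<lambda>x. bracket x y)"
    and linear_bracket_right: "Vector_Spaces.linear scaleK scaleK (\<lambda>y. bracket x y)"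
    and bracket_self: "bracket x x = 0"
    and jacobi:
      "bracket x (bracket y z) + bracket y (bracket z x) + bracket z (bracket x y) = 0"

locale LRJ_algebra =
  A: comm_algebra scaleK + module scale + K: lie_algebra "restrict_scalars scaleK scale" bracket
  for scaleK :: "'k::field_char_0 \<Rightarrow> 'a::comm_ring_1 \<Rightarrow> 'a"
    and scale :: "'a \<Rightarrow> 'g::ab_group_add \<Rightarrow> 'g"
    and bracket :: "'g \<Rightarrow> 'g \<Rightarrow> 'g" +
  fixes anchor :: "'g \<Rightarrow> 'a \<Rightarrow> 'a"
  assumes anchor_Diff1: "anchor x \<in> Diff1 scaleK"
    and anchor_add: "anchor (x + y) = (\<lambda>c. anchor x c + anchor y c)"
    and anchor_scale: "anchor (scale a x) = (\<lambda>c. a * anchor x c)"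
    and anchor_bracket: "anchor (bracket x y) = commutator (anchor x) (anchor y)"
    and bracket_scale_right:
      "bracket x (scale a y) =
         scale a (bracket x y) + scale (anchor x a - a * anchor x 1) y"


section \<open>The complex of alternating forms\<close>

text \<open>A \<open>p\<close>-form is encoded as a function of the list of its arguments, extended by \<open>0\<close> to
  lists of length other than \<open>p\<close>.  Equality of functions on lists is thus equality of forms,
  and the operators below need no explicit degree argument.\<close>

definition Alt ::
    "('a::comm_ring_1 \<Rightarrow> 'g::ab_group_add \<Rightarrow> 'g) \<Rightarrow> nat \<Rightarrow> ('g list \<Rightarrow> 'a) set"
  where "Alt scale p = {\<beta>.
    (\<forall>xs. length xs \<noteq> p \<longrightarrow> \<beta> xs = 0) \<and>
    (\<forall>xs i. length xs = p \<and> i < p \<longrightarrow> module_hom scale (*) (\<lambda>x. \<beta> (xs[i := x]))) \<and>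
    (\<forall>xs. length xs = p \<and> \<not> distinct xs \<longrightarrow> \<beta> xs = 0)}"

definition form0 :: "'a \<Rightarrow> 'g list \<Rightarrow> 'a::zero"
  where "form0 a xs = (case xs of [] \<Rightarrow> a | _ \<Rightarrow> 0)"

definition form1 :: "('g \<Rightarrow> 'a) \<Rightarrow> 'g list \<Rightarrow> 'a::zero"
  where "form1 \<phi> xs = (case xs of [x] \<Rightarrow> \<phi> x | _ \<Rightarrow> 0)"

definition omit :: "nat \<Rightarrow> 'g list \<Rightarrow> 'g list"
  where "omit i xs = take i xs @ drop (Suc i) xs"

text \<open>In the second sum \<open>i < j\<close>, so omitting position \<open>j\<close> first leaves position \<open>i\<close> in place.\<close>

definition differential ::
    "('g \<Rightarrow> 'g \<Rightarrow> 'g) \<Rightarrow> ('g \<Rightarrow> 'a \<Rightarrow> 'a) \<Rightarrow> ('g list \<Rightarrow> 'a) \<Rightarrow> 'g list \<Rightarrow> 'a::comm_ring_1"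
  where "differential bracket anchor \<beta> xs =
    (\<Sum>i<length xs. (-1) ^ i * anchor (xs ! i) (\<beta> (omit i xs))) +
    (\<Sum>j<length xs. \<Sum>i<j.
       (-1) ^ (i + j) * \<beta> (bracket (xs ! i) (xs ! j) # omit i (omit j xs)))"

definition interior :: "'g \<Rightarrow> ('g list \<Rightarrow> 'a) \<Rightarrow> 'g list \<Rightarrow> 'a"
  where "interior x \<beta> = (\<lambda>xs. \<beta> (x # xs))"

definition lie_derivative ::
    "('g \<Rightarrow> 'g \<Rightarrow> 'g) \<Rightarrow> ('g \<Rightarrow> 'a \<Rightarrow> 'a) \<Rightarrow> 'g \<Rightarrow> ('g list \<Rightarrow> 'a) \<Rightarrow> 'g list \<Rightarrow> 'a::comm_ring_1"
  where "lie_derivative bracket anchor x \<beta> = (\<lambda>xs.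
    interior x (differential bracket anchor \<beta>) xs +
    differential bracket anchor (interior x \<beta>) xs)"

definition pullback :: "('h \<Rightarrow> 'g) \<Rightarrow> ('g list \<Rightarrow> 'a) \<Rightarrow> 'h list \<Rightarrow> 'a"
  where "pullback h \<beta> = (\<lambda>us. \<beta> (map h us))"


section \<open>Symplectic forms\<close>

definition dual :: "('a::comm_ring_1 \<Rightarrow> 'g::ab_group_add \<Rightarrow> 'g) \<Rightarrow> ('g \<Rightarrow> 'a) set"
  where "dual scale = {\<phi>. module_hom scale (*) \<phi>}"

definition flat :: "('g list \<Rightarrow> 'a) \<Rightarrow> 'g \<Rightarrow> 'g \<Rightarrow> 'a"
  where "flat \<omega> x = (\<lambda>y. interior x \<omega> [y])"

locale symplectic_LRJ_algebra = LRJ_algebra scaleK scale bracket anchor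
  for scaleK :: "'k::field_char_0 \<Rightarrow> 'a::comm_ring_1 \<Rightarrow> 'a"
    and scale :: "'a \<Rightarrow> 'g::ab_group_add \<Rightarrow> 'g"
    and bracket :: "'g \<Rightarrow> 'g \<Rightarrow> 'g"
    and anchor :: "'g \<Rightarrow> 'a \<Rightarrow> 'a" +
  fixes \<omega> :: "'g list \<Rightarrow> 'a"
  assumes form: "\<omega> \<in> Alt scale 2"
    and closed: "differential bracket anchor \<omega> = (\<lambda>_. 0)"
    and flat_add: "flat \<omega> (x + y) = (\<lambda>z. flat \<omega> x z + flat \<omega> y z)"
    and flat_scale: "flat \<omega> (scale a x) = (\<lambda>z. a * flat \<omega> x z)"
    and flat_bij: "bij_betw (flat \<omega>) UNIV (dual scale)"


section \<open>The extension by a 2-form\<close>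

text \<open>The pair \<open>(x, f)\<close> stands for \<open>x + f e\<close>, so that the projection \<open>\<pi>\<close> is \<open>fst\<close>.\<close>

definition ext_scale ::
    "('a \<Rightarrow> 'g \<Rightarrow> 'g) \<Rightarrow> 'a \<Rightarrow> 'g \<times> 'a \<Rightarrow> 'g \<times> 'a::comm_ring_1"
  where "ext_scale scale a = (\<lambda>(x, f). (scale a x, a * f))"

definition ext_bracket ::
    "('g \<Rightarrow> 'g \<Rightarrow> 'g) \<Rightarrow> ('g \<Rightarrow> 'a \<Rightarrow> 'a) \<Rightarrow> ('g list \<Rightarrow> 'a) \<Rightarrow>
     'g \<times> 'a \<Rightarrow> 'g \<times> 'a \<Rightarrow> 'g \<times> 'a::comm_ring_1"
  where "ext_bracket bracket anchor \<omega> = (\<lambda>(x, f) (y, g).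
    (bracket x y, anchor x g - anchor y f + \<omega> [x, y]))"

definition ext_anchor :: "('g \<Rightarrow> 'a \<Rightarrow> 'a) \<Rightarrow> 'g \<times> 'a \<Rightarrow> 'a \<Rightarrow> 'a"
  where "ext_anchor anchor = (\<lambda>(x, f). anchor x)"

definition canonical_form :: "('g \<times> 'a) list \<Rightarrow> 'a::zero"
  where "canonical_form = form1 snd"

lemma canonical_form_in_Alt:
  fixes scale :: "'a::comm_ring_1 \<Rightarrow> 'g::ab_group_add \<Rightarrow> 'g"
  assumes "module scale"
  shows "canonical_form \<in> Alt (ext_scale scale) 1"
proof -
  interpret module scale by fact
  show ?thesis unfolding Alt_def
  proof (intro CollectI conjI allI impI)
   fix xs :: "('g\<times>'a) list" and i :: nat assume "length xs = 1 \<and> i < 1"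
   then have "xs[i:=x] = [x]" for x by (auto simp: length_Suc_conv)
   then show "module_hom (ext_scale scale) (*) (\<lambda>x. canonical_form (xs[i := x]))"
    by (auto simp: canonical_form_def form1_def ext_scale_def module_hom_iff module_def algebra_simps)
  qed (auto simp: canonical_form_def form1_def length_Suc_conv split: list.splits)
qed

lemma LRJ_algebra_extension:
  fixes scaleK :: "'k::field_char_0 \<Rightarrow> 'a::comm_ring_1 \<Rightarrow> 'a"
    and scale :: "'a \<Rightarrow> 'g::ab_group_add \<Rightarrow> 'g"
  assumes "LRJ_algebra scaleK scale bracket anchor" and form: "\<omega> \<in> Alt scale 2"
    and cl: "differential bracket anchor \<omega> = (\<lambda>_. 0)"
  shows "LRJ_algebra scaleK (ext_scale scale) (ext_bracket bracket anchor \<omega>) (ext_anchor anchor)"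
proof -
  interpret LRJ_algebra scaleK scale bracket anchor by fact
  have lin: "Vector_Spaces.linear scaleK scaleK (anchor x)" for x
    using anchor_Diff1 by (auto simp: Diff1_def)
  have aa: "anchor x (a + b) = anchor x a + anchor x b" for x a b
    using lin[of x] by (simp add: Vector_Spaces.linear_iff)
  have ak: "anchor x (scaleK k b) = scaleK k (anchor x b)" for x k b
    using lin[of x] by (simp add: Vector_Spaces.linear_iff)
  have a0[simp]: "anchor x 0 = 0" for x using aa[of x 0 0] by simp
  have am: "anchor x (- b) = - anchor x b" for x b
    using aa[of x b "-b"] by (simp add: eq_neg_iff_add_eq_0 add.commute)
  have ad: "anchor x (a - b) = anchor x a - anchor x b" for x a b
    using aa[of x a "-b"] am by simp
  have der: "anchor x (a * b) = a * anchor x b + b * anchor x a - a * b * anchor x 1" for x a b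
  proof -
    have "commutator (commutator (anchor x) ((*) a)) ((*) b) 1 = 0"
      using anchor_Diff1[of x] by (simp add: Diff1_def)
    then show ?thesis by (simp add: commutator_def algebra_simps)
  qed
  have k1: "scaleK k a = scaleK k 1 * a" for k a using A.scaleK_mult_left[of k 1 a] by simp
  have mh: "module_hom scale (*) (\<lambda>x. \<omega> (xs[i := x]))" if "length xs = 2" "i<2" for xs i
    using form that by (auto simp: Alt_def)
  have w1: "module_hom scale (*) (\<lambda>x. \<omega> [x,y])" for y using mh[of "[0,y]" 0] by simp
  have w2: "module_hom scale (*) (\<lambda>x. \<omega> [y,x])" for y using mh[of "[y,0]" 1] by simp
  have wd: "\<omega> [x,x] = 0" for x using form by (auto simp: Alt_def)
  note W = w1[THEN module_hom.add] w2[THEN module_hom.add] w1[THEN module_hom.scale] w2[THEN module_hom.scale]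
  have wa: "\<omega> [x,y] = - \<omega> [y,x]" for x y
    using wd[of "x+y"] w1[of "x+y", THEN module_hom.add, of x y] w2[of x, THEN module_hom.add, of x y] w2[of y, THEN module_hom.add, of x y] wd[of x] wd[of y] by (simp add: eq_neg_iff_add_eq_0)
  have bl: "bracket (x+y) z = bracket x z + bracket y z" 
     "bracket (restrict_scalars scaleK scale k x) z = restrict_scalars scaleK scale k (bracket x z)" for x y z k
    using K.linear_bracket_left[of z] by (simp_all add: Vector_Spaces.linear_iff)
  have br: "bracket z (x+y) = bracket z x + bracket z y" 
     "bracket z (restrict_scalars scaleK scale k x) = restrict_scalars scaleK scale k (bracket z x)" for x y z k
    using K.linear_bracket_right[of z] by (simp_all add: Vector_Spaces.linear_iff)
  have ba: "bracket x y = - bracket y x" for x y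
    using K.bracket_self[of "x+y"] bl(1)[of x y "x+y"] br(1)[of x x y] br(1)[of y x y] K.bracket_self[of x] K.bracket_self[of y] by (simp add: eq_neg_iff_add_eq_0)
  have cc: "anchor x (\<omega> [y,z]) - anchor y (\<omega> [x,z]) + anchor z (\<omega> [x,y])
     - \<omega> [bracket x y, z] + \<omega> [bracket x z, y] - \<omega> [bracket y z, x] = 0" for x y z
    using fun_cong[OF cl, of "[x,y,z]"]
    by (simp add: differential_def omit_def numeral_3_eq_3 lessThan_Suc algebra_simps numeral_2_eq_2)
  have vs: "vector_space (restrict_scalars scaleK (ext_scale scale))"
    by unfold_locales (auto simp: restrict_scalars_def ext_scale_def algebra_simps A.scale_left_distrib A.scaleK_mult_left[symmetric] A.scale_scale split: prod.splits)
  let ?B = "ext_bracket bracket anchor \<omega>"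
  have J: "?B x (?B y z) + ?B y (?B z x) + ?B z (?B x y) = 0" for x y z
   apply (cases x; cases y; cases z)
   apply (simp add: ext_bracket_def K.jacobi zero_prod_def)
   subgoal for x f y g z h
    using fun_cong[OF anchor_bracket[of z x], of g] cc[of x y z] wa[of x "bracket y z"] wa[of y "bracket z x"] wa[of z "bracket x y"] ba[of z x] w1[THEN module_hom.neg, of "bracket x z" y]
      wa[of z x] am[of y "\<omega> [x,z]"]
    by (simp add: anchor_bracket commutator_def aa ad algebra_simps)
   done
  show ?thesis
  apply (unfold_locales)
  apply (simp_all only: J)
  apply (auto simp: vs Vector_Spaces.linear_iff restrict_scalars_def ext_scale_def ext_bracket_def ext_anchor_def
   algebra_simps K.bracket_self anchor_Diff1 anchor_add anchor_scale anchor_bracket wd zero_prod_def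
   bl[unfolded restrict_scalars_def] br[unfolded restrict_scalars_def] W aa ad ak der bracket_scale_right A.scaleK_mult_left[symmetric] A.scale_left_distrib k1[symmetric]
   module_iff_vector_space)
  apply (metis k1 mult.commute)+ done
qed

end

theory Submission
  imports Defs
begin

text \<open>
  The formula is Cartan's identity applied to two facts about \<open>\<eta>\<close>.

  The extension is built so that \<open>\<eta>\<close> is a primitive of \<open>-\<pi>\<^sup>*\<omega>\<close>
  (\<open>differential_canonical_form\<close>): in \<open>d\<eta>(x + f e, y + g e)\<close> the two anchor terms
  \<open>\<rho>(x)(g) - \<rho>(y)(f)\<close> cancel against the same terms in the \<open>e\<close>-component of the bracket, and
  only \<open>-\<omega>(x, y)\<close> survives.  Contracting with \<open>x + f e\<close> gives \<open>-\<pi>\<^sup>*(i\<^sub>x\<omega>)\<close>.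

  On the other hand \<open>i\<^sub>x\<^sub>+\<^sub>f\<^sub>e \<eta> = f\<close>, which is the pullback of the \<open>0\<close>-form \<open>f\<close>, and the
  projection \<open>\<pi>\<close> preserves anchors and brackets, so \<open>\<pi>\<^sup>*\<close> commutes with the differentials
  (\<open>differential_pullback\<close>).  This gives \<open>d(i\<^sub>x\<^sub>+\<^sub>f\<^sub>e \<eta>) = \<pi>\<^sup>*(d f)\<close>.
\<close>

lemma length_omit: "i < length xs \<Longrightarrow> length (omit i xs) = length xs - 1"
  by (simp add: omit_def)

lemma map_omit: "map h (omit i xs) = omit i (map h xs)"
  by (simp add: omit_def take_map drop_map)

lemma differential_pullback:
  assumes "\<And>u. anchor' u = anchor (h u)"
    and "\<And>u v. h (bracket' u v) = bracket (h u) (h v)"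
  shows "differential bracket' anchor' (pullback h \<beta>) = pullback h (differential bracket anchor \<beta>)"
  by (rule ext) (simp add: differential_def pullback_def map_omit assms)

lemma interior_pullback: "interior u (pullback h \<beta>) = pullback h (interior (h u) \<beta>)"
  by (simp add: interior_def pullback_def)

lemma pullback_form0: "pullback h (form0 a) = form0 a"
  by (rule ext) (simp add: pullback_def form0_def split: list.splits)

lemma interior_canonical_form: "interior u canonical_form = form0 (snd u)"
  by (rule ext) (simp add: interior_def canonical_form_def form1_def form0_def split: list.splits)

lemma canonical_form_eq_0: "length us \<noteq> 1 \<Longrightarrow> canonical_form us = 0"
  by (auto simp: canonical_form_def form1_def split: list.splits)

lemma (in LRJ_algebra) anchor_zero: "anchor x 0 = 0"
proof -
  have "Vector_Spaces.linear scaleK scaleK (anchor x)"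
    using anchor_Diff1 by (simp add: Diff1_def)
  then have "anchor x (0 + 0) = anchor x 0 + anchor x 0"
    unfolding Vector_Spaces.linear_iff by blast
  then show ?thesis by simp
qed

text \<open>In degree two this is the cancellation built into the bracket of the extension.  The other
  lengths have to be treated because a form is a function on lists of every length; there each
  summand of the differential contains \<open>\<eta>\<close> evaluated on a list of length other than one.\<close>

lemma (in LRJ_algebra) differential_canonical_form:
  assumes "\<omega> \<in> Alt scale 2"
  shows "differential (ext_bracket bracket anchor \<omega>) (ext_anchor anchor) canonical_form =
    (\<lambda>us. - pullback fst \<omega> us)"
proof
  fix us
  let ?d = "differential (ext_bracket bracket anchor \<omega>) (ext_anchor anchor) canonical_form"
  show "?d us = - pullback fst \<omega> us"
  proof (cases "length us = 2")
    case True
    then obtain x f y g where "us = [(x, f), (y, g)]"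
      by (auto simp: numeral_2_eq_2 length_Suc_conv)
    then show ?thesis
      by (simp add: differential_def omit_def ext_anchor_def ext_bracket_def canonical_form_def
          form1_def pullback_def lessThan_Suc numeral_2_eq_2)
  next
    case False
    have "canonical_form (omit i us) = 0" if "i < length us" for i
      using that False by (intro canonical_form_eq_0) (simp add: length_omit)
    moreover have "canonical_form (u # omit i (omit j us)) = 0" if "i < j" "j < length us" for u i j
      using that False by (intro canonical_form_eq_0) (simp add: length_omit)
    ultimately have "?d us = 0"
      by (simp add: differential_def ext_anchor_def anchor_zero case_prod_unfold)
    moreover have "pullback fst \<omega> us = 0"
      using assms False by (simp add: Alt_def pullback_def)
    ultimately show ?thesis by simp
  qed
qed

theorem lemma6p2:
  fixes scaleK :: "'k::field_char_0 \<Rightarrow> 'a::comm_ring_1 \<Rightarrow> 'a"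
    and scale :: "'a \<Rightarrow> 'g::ab_group_add \<Rightarrow> 'g"
    and bracket :: "'g \<Rightarrow> 'g \<Rightarrow> 'g"
    and anchor :: "'g \<Rightarrow> 'a \<Rightarrow> 'a"
    and \<omega> :: "'g list \<Rightarrow> 'a"
    and x :: 'g
    and f :: 'a
  assumes "symplectic_LRJ_algebra scaleK scale bracket anchor \<omega>"
  shows "lie_derivative (ext_bracket bracket anchor \<omega>) (ext_anchor anchor) (x, f) canonical_form =
    pullback fst (\<lambda>xs. differential bracket anchor (form0 f) xs - interior x \<omega> xs)"
proof -
  interpret symplectic_LRJ_algebra scaleK scale bracket anchor \<omega> by fact
  let ?d = "differential (ext_bracket bracket anchor \<omega>) (ext_anchor anchor)"
  have "interior (x, f) (?d canonical_form) us = - pullback fst (interior x \<omega>) us" for us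
    using interior_pullback[of "(x, f)" fst \<omega>]
    by (simp add: differential_canonical_form[OF form] interior_def fun_eq_iff)
  moreover have "?d (interior (x, f) canonical_form) =
      pullback fst (differential bracket anchor (form0 f))"
  proof -
    have "?d (pullback fst (form0 f)) = pullback fst (differential bracket anchor (form0 f))"
      by (rule differential_pullback) (simp_all add: ext_anchor_def ext_bracket_def split: prod.splits)
    then show ?thesis by (simp add: interior_canonical_form pullback_form0)
  qed
  ultimately show ?thesis
    by (simp add: lie_derivative_def pullback_def fun_eq_iff)
qed

end
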